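(* Let $m,n\ge 2$, and let $P$ be a transition probability tensor represented as an $n\times n^{m-1}$ matrix such that $P\mathbf{x}^{(m-1)}=\mathbf{x}$ for all $\mathbf{x}\in\Omega_n$. Let $\tilde P=[P\,|\,\cdots\,|\,P]=\mathbf{1}\otimes P$ be the $n\times n^m$ matrix consisting of $n$ copies of $P$, where $\mathbf{1}=(1,\dots,1)\in\mathbf{R}^{1\times n}$. Then $$\tilde P\mathbf{x}^{(m)}=(\mathbf{1}\otimes P)(\mathbf{x}\otimes\mathbf{x}^{(m-1)})=(\mathbf{1}\mathbf{x})\otimes(P\mathbf{x}^{(m-1)})=\mathbf{x}\qquad\text{for all }\mathbf{x}\in\Omega_n.$$ Moreover, for each sequence of nonnegative integers $(m_1,\dots,m_n)$ with $m_1+\cdots+m_n=m$, one can arbitrarily permute among themselves the columns of $\tilde P$ corresponding to the entries of $\mathbf{x}^{(m)}$ equal to $x_1^{m_1}\cdots x_n^{m_n}$ (i.e. the columns with index $i_1\cdots i_m$ in which each $j\in\{1,\dots,n\}$ occurs exactly $m_j$ times), and any matrix $Q$ obtained from $\tilde P$ by such permutations (carried out for all $(m_1,\dots,m_n)$) is the transition probability tensor of an $m$-th order Markov chain satisfying $Q\mathbf{x}^{(m)}=\mathbf{x}$ for all $\mathbf{x}\in\Omega_n$. In addition, every convex combination $Q$ of matrices so obtained is also the transition probability tensor of an $m$-th order Markov chain satisfying $Q\mathbf{x}^{(m)}=\mathbf{x}$ for all $\mathbf{x}\in\Omega_n$.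
   Context: $\Omega_n=\{\mathbf{x}=(x_1,\dots,x_n)^t\in\mathbf{R}^n: x_1,\dots,x_n\ge 0,\ \sum_{i=1}^n x_i=1\}$. The transition probability tensor of an $m$-th order Markov chain on $\{1,\dots,n\}$ is a real array $P=(p_{i,i_1,\dots,i_m})$, $i,i_1,\dots,i_m\in\{1,\dots,n\}$, with nonnegative entries and $\sum_{i=1}^n p_{i,i_1,\dots,i_m}=1$ for all $i_1,\dots,i_m$. It is identified with the $n\times n^m$ matrix with row index $i$ and column indexes $i_1\cdots i_m$ arranged in lexicographic order. For $\mathbf{x}\in\mathbf{R}^n$, $\mathbf{x}^{(m)}=\mathbf{x}\otimes\cdots\otimes\mathbf{x}$ ($m$ factors, Kronecker product) is the column vector in $\mathbf{R}^{n^m}$ whose entry indexed by $i_1\cdots i_m$ (lexicographic order) is $x_{i_1}\cdots x_{i_m}$. The stationary vector condition for $\mathbf{x}\in\Omega_n$ is $P\mathbf{x}^{(m)}=\mathbf{x}$. *)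

theory Defs
  imports "Jordan_Normal_Form.Matrix" "HOL-Combinatorics.Permutations"
begin

text \<open>States, and hence the indices of all vectors, matrices and tensors, are numbered
  from \<open>0\<close> to \<open>n - 1\<close>.\<close>

definition prob_simplex :: "nat \<Rightarrow> real vec set" where
  "prob_simplex n = {x \<in> carrier_vec n. (\<forall>i<n. 0 \<le> x $ i) \<and> (\<Sum>i<n. x $ i) = 1}"

definition multi_indices :: "nat \<Rightarrow> nat \<Rightarrow> nat list set" where
  "multi_indices n m = {is. length is = m \<and> set is \<subseteq> {..<n}}"

text \<open>The position of the multi-index \<open>i\<^sub>1 \<dots> i\<^sub>m\<close> in lexicographic order is
  \<open>i\<^sub>1 n\<^sup>m\<^sup>-\<^sup>1 + \<dots> + i\<^sub>m\<close>; \<open>horner_sum\<close> expects the least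
  significant digit first. Compare \<open>bij_betw_lex_index\<close> and \<open>lex_index_less_iff\<close>.\<close>

definition lex_index :: "nat \<Rightarrow> nat list \<Rightarrow> nat" where
  "lex_index n is = horner_sum id n (rev is)"

text \<open>The tensor of an \<open>m\<close>-th order Markov chain, in its matrix form: the entry
  \<open>p\<^bsub>i, i\<^sub>1, \<dots>, i\<^sub>m\<^esub>\<close> is
  \<open>P $$ (i, lex_index n [i\<^sub>1, \<dots>, i\<^sub>m])\<close>.\<close>

definition transition_tensor :: "nat \<Rightarrow> nat \<Rightarrow> real mat \<Rightarrow> bool" where
  "transition_tensor n m P \<longleftrightarrow>
     P \<in> carrier_mat n (n ^ m) \<and>
     (\<forall>i<n. \<forall>is\<in>multi_indices n m. 0 \<le> P $$ (i, lex_index n is)) \<and>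
     (\<forall>is\<in>multi_indices n m. (\<Sum>i<n. P $$ (i, lex_index n is)) = 1)"

definition kron_mat :: "real mat \<Rightarrow> real mat \<Rightarrow> real mat"  (infixr "\<otimes>\<^sub>m" 72) where
  "A \<otimes>\<^sub>m B = mat (dim_row A * dim_row B) (dim_col A * dim_col B)
     (\<lambda>(i, j). A $$ (i div dim_row B, j div dim_col B) * B $$ (i mod dim_row B, j mod dim_col B))"

definition kron_vec :: "real vec \<Rightarrow> real vec \<Rightarrow> real vec"  (infixr "\<otimes>\<^sub>v" 72) where
  "v \<otimes>\<^sub>v w = vec (dim_vec v * dim_vec w) (\<lambda>k. v $ (k div dim_vec w) * w $ (k mod dim_vec w))"

primrec kron_pow :: "real vec \<Rightarrow> nat \<Rightarrow> real vec" where
  "kron_pow x 0 = vec 1 (\<lambda>_. 1)"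
| "kron_pow x (Suc m) = x \<otimes>\<^sub>v kron_pow x m"

definition ones_row :: "nat \<Rightarrow> real mat" where
  "ones_row n = mat 1 n (\<lambda>_. 1)"

text \<open>The block matrix \<open>[P | \<dots> | P]\<close> with \<open>k\<close> blocks.\<close>

definition repeat_blocks :: "nat \<Rightarrow> real mat \<Rightarrow> real mat" where
  "repeat_blocks k P = mat_of_cols (dim_row P) (concat (replicate k (cols P)))"

text \<open>The exponent sequences \<open>(m\<^sub>1, \<dots>, m\<^sub>n)\<close> with sum \<open>m\<close>, and the
  columns whose multi-index contains each \<open>j\<close> exactly \<open>m\<^sub>j\<close> times.\<close>

definition exponent_seqs :: "nat \<Rightarrow> nat \<Rightarrow> nat list set" where
  "exponent_seqs n m = {ms. length ms = n \<and> sum_list ms = m}"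

definition monomial_columns :: "nat \<Rightarrow> nat \<Rightarrow> nat list \<Rightarrow> nat set" where
  "monomial_columns n m ms =
     lex_index n ` {is \<in> multi_indices n m. \<forall>j<n. count_list is j = ms ! j}"

definition column_rearrangements :: "nat \<Rightarrow> nat \<Rightarrow> real mat \<Rightarrow> real mat set" where
  "column_rearrangements n m A = {Q \<in> carrier_mat n (n ^ m).
     \<forall>ms\<in>exponent_seqs n m. \<exists>\<pi>. \<pi> permutes monomial_columns n m ms \<and>
       (\<forall>c\<in>monomial_columns n m ms. col Q c = col A (\<pi> c))}"

text \<open>Matrices of varying dimension do not form a real vector space type, so
  \<open>convex hull\<close> is not available for them.\<close>

definition convex_combinations :: "nat \<Rightarrow> nat \<Rightarrow> real mat set \<Rightarrow> real mat set" where
  "convex_combinations r c S =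
     {mat r c (\<lambda>ij. \<Sum>l<k. w l * R l $$ ij) | (k :: nat) (w :: nat \<Rightarrow> real) (R :: nat \<Rightarrow> real mat).
        (\<forall>l<k. R l \<in> S \<and> 0 \<le> w l) \<and> (\<Sum>l<k. w l) = 1}"

lemma lex_index_Nil [simp]: "lex_index n [] = 0"
  by (simp add: lex_index_def)

lemma lex_index_Cons [simp]: "lex_index n (i # is) = i * n ^ length is + lex_index n is"
  by (simp add: lex_index_def horner_sum_append)

lemma lex_index_less: "set is \<subseteq> {..<n} \<Longrightarrow> lex_index n is < n ^ length is"
proof (induction "is")
  case (Cons i "is")
  have "lex_index n (i # is) < (i + 1) * n ^ length is" using Cons by simp
  also have "\<dots> \<le> n * n ^ length is" using Cons.prems by (intro mult_right_mono) auto
  finally show ?case by simp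
qed simp

lemma lex_index_less_iff:
  assumes "is \<in> multi_indices n m" "js \<in> multi_indices n m"
  shows "lex_index n is < lex_index n js \<longleftrightarrow> (is, js) \<in> lexord {(i, j). i < j}"
  using assms
proof (induction m arbitrary: "is" js)
  case (Suc m)
  obtain i is' j js' where eq: "is = i # is'" "js = j # js'"
    using Suc.prems by (auto simp: multi_indices_def length_Suc_conv)
  have mem: "is' \<in> multi_indices n m" "js' \<in> multi_indices n m"
    using Suc.prems by (auto simp: eq multi_indices_def)
  have len: "length is' = m" "length js' = m" using mem by (auto simp: multi_indices_def)
  have b: "lex_index n is' < n ^ m" "lex_index n js' < n ^ m"
    using mem lex_index_less[of is' n] lex_index_less[of js' n] by (auto simp: multi_indices_def)
  have step: "a * n ^ m + u < b * n ^ m + v" if "a < b" "u < n ^ m" for a b u v :: nat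
  proof -
    have "a * n ^ m + u < (a + 1) * n ^ m" using that by simp
    also have "\<dots> \<le> b * n ^ m" using that by (intro mult_right_mono) auto
    finally show ?thesis by simp
  qed
  consider "i < j" | "i = j" | "j < i" by linarith
  then show ?case
    using step[of i j "lex_index n is'" "lex_index n js'"]
      step[of j i "lex_index n js'" "lex_index n is'"] b Suc.IH[OF mem]
    by cases (auto simp: eq len)
qed (simp add: multi_indices_def)

lemma bij_betw_lex_index: "bij_betw (lex_index n) (multi_indices n m) {..<n ^ m}"
proof -
  have inj: "inj_on (lex_index n) (multi_indices n m)"
  proof (rule inj_onI)
    fix "is" js
    assume *: "is \<in> multi_indices n m" "js \<in> multi_indices n m" "lex_index n is = lex_index n js"
    have "\<not> (is, js) \<in> lexord {(i, j). i < j}" "\<not> (js, is) \<in> lexord {(i, j). i < j}"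
      using lex_index_less_iff[OF *(1,2)] lex_index_less_iff[OF *(2,1)] *(3) by auto
    moreover have "(is, js) \<in> lexord {(i, j). i < j} \<or> is = js \<or> (js, is) \<in> lexord {(i, j :: nat). i < j}"
      by (rule lexord_linear) auto
    ultimately show "is = js" by blast
  qed
  have sub: "lex_index n ` multi_indices n m \<subseteq> {..<n ^ m}"
    using lex_index_less by (auto simp: multi_indices_def)
  have "multi_indices n m = {is. set is \<subseteq> {..<n} \<and> length is = m}"
    by (auto simp: multi_indices_def)
  then have "card (multi_indices n m) = n ^ m"
    by (simp add: card_lists_length_eq)
  then have "lex_index n ` multi_indices n m = {..<n ^ m}"
    using sub by (intro card_subset_eq) (auto simp: card_image[OF inj])
  with inj show ?thesis by (simp add: bij_betw_def)
qed

lemma dim_kron_pow [simp]: "dim_vec (kron_pow x m) = dim_vec x ^ m"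
  by (induction m) (auto simp: kron_vec_def)

lemma kron_pow_lex_index:
  assumes "x \<in> carrier_vec n" "is \<in> multi_indices n m"
  shows "kron_pow x m $ lex_index n is = prod_list (map (\<lambda>i. x $ i) is)"
  using assms(2)
proof (induction m arbitrary: "is")
  case (Suc m)
  obtain i is' where eq: "is = i # is'"
    using Suc.prems by (auto simp: multi_indices_def length_Suc_conv)
  have mem: "is' \<in> multi_indices n m" and len: "length is' = m"
    using Suc.prems by (auto simp: eq multi_indices_def)
  have b: "lex_index n is' < n ^ m" "lex_index n is < n * n ^ m"
    using lex_index_less[of is' n] lex_index_less[of "is" n] Suc.prems
    by (auto simp: multi_indices_def eq)
  have "dim_vec x = n" using assms(1) by simp
  with b have "kron_pow x (Suc m) $ lex_index n is =
      x $ (lex_index n is div n ^ m) * kron_pow x m $ (lex_index n is mod n ^ m)"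
    by (simp add: kron_vec_def)
  also have "lex_index n is div n ^ m = i"
  proof -
    have "n ^ m \<noteq> 0" using b(1) by linarith
    from div_mult_self3[OF this, of i "lex_index n is'"] b(1) show ?thesis
      by (metis add_0_right div_less eq len lex_index_Cons)
  qed
  also have "lex_index n is mod n ^ m = lex_index n is'" using b(1) by (simp add: eq len)
  finally show ?case by (simp add: Suc.IH[OF mem] eq)
qed (simp add: multi_indices_def)

end

theory Submission
  imports Defs
begin

text \<open>
  The identity for \<open>[P | \<dots> | P]\<close> is the mixed product rule
  \<open>(A \<otimes> B)(v \<otimes> w) = (A v) \<otimes> (B w)\<close>, lemma \<open>kron_mat_mult_kron_vec\<close>, since the
  entries of a probability vector have the sum \<open>1\<close>.

  For the rearrangements, note that the product \<open>A x\<^sup>(\<^sup>m\<^sup>)\<close> is the sum of the columns of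
  \<open>A\<close>, each multiplied by the corresponding monomial of degree \<open>m\<close> in the entries of \<open>x\<close>.
  Multiplication of numbers is commutative, so this monomial depends only on how often each
  state occurs in the multi-index. Hence the columns of one class
  \<open>monomial_columns n m ms\<close> all get the same coefficient, only their sum matters, and
  permuting them changes nothing (lemma \<open>column_rearrangement_mult_kron_pow\<close>). The classes
  cover all columns, so each column of a rearrangement is a column of the original tensor, and
  stochasticity is inherited too. Stochasticity and the equation \<open>Q x\<^sup>(\<^sup>m\<^sup>) = x\<close> are
  conditions that survive averaging, which settles convex combinations.
\<close>

section \<open>Kronecker products\<close>

lemma sum_div_mod:
  fixes f :: "nat \<Rightarrow> nat \<Rightarrow> 'a :: comm_monoid_add"
  shows "(\<Sum>j<a * b. f (j div b) (j mod b)) = (\<Sum>p<a. \<Sum>q<b. f p q)"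
proof -
  have "(\<Sum>j<a * b. f (j div b) (j mod b)) =
      (\<Sum>p<a. \<Sum>j = p * b..<p * b + b. f (j div b) (j mod b))"
    by (rule sum.nat_group [symmetric])
  also have "\<dots> = (\<Sum>p<a. \<Sum>q<b. f p q)"
  proof (rule sum.cong [OF refl])
    fix p
    have "(\<Sum>j = p * b..<p * b + b. f (j div b) (j mod b)) =
        (\<Sum>q = 0..<b. f ((q + p * b) div b) ((q + p * b) mod b))"
      using sum.shift_bounds_nat_ivl [of "\<lambda>j. f (j div b) (j mod b)" 0 "p * b" b]
      by (simp add: add.commute)
    also have "\<dots> = (\<Sum>q<b. f p q)"
      by (rule sum.cong) auto
    finally show "(\<Sum>j = p * b..<p * b + b. f (j div b) (j mod b)) = (\<Sum>q<b. f p q)" .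
  qed
  finally show ?thesis .
qed

lemma mult_mat_vec_index:
  assumes "A \<in> carrier_mat r c" "v \<in> carrier_vec c" "i < r"
  shows "(A *\<^sub>v v) $ i = (\<Sum>j<c. A $$ (i, j) * v $ j)"
  using assms by (auto simp: scalar_prod_def atLeast0LessThan intro!: sum.cong)

text \<open>Splitting a column index \<open>j\<close> of \<open>A \<otimes> B\<close> into quotient and remainder turns each entry
  of the left-hand side into a double sum, which factors.\<close>

lemma kron_mat_mult_kron_vec:
  assumes A: "A \<in> carrier_mat ra ca" and B: "B \<in> carrier_mat rb cb"
    and v: "v \<in> carrier_vec ca" and w: "w \<in> carrier_vec cb"
  shows "(A \<otimes>\<^sub>m B) *\<^sub>v (v \<otimes>\<^sub>v w) = (A *\<^sub>v v) \<otimes>\<^sub>v (B *\<^sub>v w)"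
proof (rule eq_vecI)
  show "dim_vec ((A \<otimes>\<^sub>m B) *\<^sub>v (v \<otimes>\<^sub>v w)) = dim_vec ((A *\<^sub>v v) \<otimes>\<^sub>v (B *\<^sub>v w))"
    by (simp add: kron_mat_def kron_vec_def)
next
  fix i
  assume "i < dim_vec ((A *\<^sub>v v) \<otimes>\<^sub>v (B *\<^sub>v w))"
  then have i: "i < ra * rb" using A B by (simp add: kron_vec_def)
  then have "0 < rb" by (cases rb) auto
  then have ib: "i div rb < ra" "i mod rb < rb"
    using i by (auto simp: less_mult_imp_div_less)
  have AB: "A \<otimes>\<^sub>m B \<in> carrier_mat (ra * rb) (ca * cb)"
    and vw: "v \<otimes>\<^sub>v w \<in> carrier_vec (ca * cb)"
    using A B v w by (auto simp: kron_mat_def kron_vec_def)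
  have "((A \<otimes>\<^sub>m B) *\<^sub>v (v \<otimes>\<^sub>v w)) $ i =
      (\<Sum>j<ca * cb. (A $$ (i div rb, j div cb) * v $ (j div cb)) *
         (B $$ (i mod rb, j mod cb) * w $ (j mod cb)))"
    unfolding mult_mat_vec_index [OF AB vw i]
    using A B v w i by (intro sum.cong) (auto simp: kron_mat_def kron_vec_def)
  also have "\<dots> = (\<Sum>p<ca. \<Sum>q<cb. (A $$ (i div rb, p) * v $ p) * (B $$ (i mod rb, q) * w $ q))"
    by (rule sum_div_mod)
  also have "\<dots> = (A *\<^sub>v v) $ (i div rb) * (B *\<^sub>v w) $ (i mod rb)"
    unfolding mult_mat_vec_index [OF A v ib(1)] mult_mat_vec_index [OF B w ib(2)]
    by (rule sum_product [symmetric])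
  also have "\<dots> = ((A *\<^sub>v v) \<otimes>\<^sub>v (B *\<^sub>v w)) $ i"
    using A B i by (simp add: kron_vec_def)
  finally show "((A \<otimes>\<^sub>m B) *\<^sub>v (v \<otimes>\<^sub>v w)) $ i = ((A *\<^sub>v v) \<otimes>\<^sub>v (B *\<^sub>v w)) $ i" .
qed

lemma length_concat_replicate: "length (concat (replicate k xs)) = k * length xs"
  by (induction k) auto

lemma nth_concat_replicate:
  "j < k * length xs \<Longrightarrow> concat (replicate k xs) ! j = xs ! (j mod length xs)"
  by (induction k arbitrary: j) (auto simp: nth_append le_mod_geq)

lemma repeat_blocks_eq_kron: "repeat_blocks k P = ones_row k \<otimes>\<^sub>m P"
proof (rule eq_matI)
  fix i j
  assume "i < dim_row (ones_row k \<otimes>\<^sub>m P)" "j < dim_col (ones_row k \<otimes>\<^sub>m P)"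
  then have i: "i < dim_row P" and j: "j < k * dim_col P"
    by (auto simp: kron_mat_def ones_row_def)
  then have c: "0 < dim_col P" by (cases "dim_col P") auto
  have "repeat_blocks k P $$ (i, j) = cols P ! (j mod dim_col P) $ i"
    using i j
    by (simp add: repeat_blocks_def mat_of_cols_index length_concat_replicate nth_concat_replicate)
  also have "\<dots> = P $$ (i, j mod dim_col P)" using i c by simp
  also have "\<dots> = (ones_row k \<otimes>\<^sub>m P) $$ (i, j)"
    using i j by (simp add: kron_mat_def ones_row_def less_mult_imp_div_less)
  finally show "repeat_blocks k P $$ (i, j) = (ones_row k \<otimes>\<^sub>m P) $$ (i, j)" .
qed (auto simp: repeat_blocks_def kron_mat_def ones_row_def length_concat_replicate)

lemma ones_row_mult_prob_simplex:
  assumes "x \<in> prob_simplex n"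
  shows "ones_row n *\<^sub>v x = vec 1 (\<lambda>_. 1)"
  using assms
  by (intro eq_vecI)
    (auto simp: ones_row_def prob_simplex_def scalar_prod_def atLeast0LessThan)

lemma one_kron_vec: "vec 1 (\<lambda>_. 1) \<otimes>\<^sub>v x = x"
  by (intro eq_vecI) (auto simp: kron_vec_def)

lemma kron_pow_carrier: "x \<in> carrier_vec n \<Longrightarrow> kron_pow x m \<in> carrier_vec (n ^ m)"
  by (intro carrier_vecI) auto

section \<open>Stochastic columns\<close>

text \<open>Every column number is the position of a multi-index, so the conditions on multi-indices
  amount to conditions on column numbers.\<close>

lemma transition_tensor_iff:
  "transition_tensor n m P \<longleftrightarrow>
     P \<in> carrier_mat n (n ^ m) \<and>
     (\<forall>c<n ^ m. (\<forall>i<n. 0 \<le> P $$ (i, c)) \<and> (\<Sum>i<n. P $$ (i, c)) = 1)"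
proof -
  have all_columns: "(\<forall>c<n ^ m. R c) \<longleftrightarrow> (\<forall>is\<in>multi_indices n m. R (lex_index n is))" for R
    unfolding lessThan_iff [symmetric] Ball_def [symmetric]
      bij_betw_imp_surj_on [OF bij_betw_lex_index, of n m, symmetric] by simp
  show ?thesis
    unfolding transition_tensor_def all_columns by auto
qed

lemma transition_tensor_cols:
  assumes A: "transition_tensor n m A" and Q: "Q \<in> carrier_mat n (n ^ k)"
    and cols: "\<And>c. c < n ^ k \<Longrightarrow> \<exists>d<n ^ m. \<forall>i<n. Q $$ (i, c) = A $$ (i, d)"
  shows "transition_tensor n k Q"
  unfolding transition_tensor_iff
proof (intro conjI Q allI impI)
  fix c assume "c < n ^ k"
  from cols [OF this] obtain d where d: "d < n ^ m" "\<forall>i<n. Q $$ (i, c) = A $$ (i, d)"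
    by blast
  then show "0 \<le> Q $$ (i, c)" if "i < n" for i
    using A that by (simp add: transition_tensor_iff)
  have "(\<Sum>i<n. Q $$ (i, c)) = (\<Sum>i<n. A $$ (i, d))"
    using d by (intro sum.cong) auto
  then show "(\<Sum>i<n. Q $$ (i, c)) = 1"
    using A d(1) by (simp add: transition_tensor_iff)
qed

lemma transition_tensor_repeat_blocks:
  assumes "transition_tensor n m P"
  shows "transition_tensor n (Suc m) (repeat_blocks n P)"
proof (rule transition_tensor_cols [OF assms])
  have P: "P \<in> carrier_mat n (n ^ m)"
    using assms by (simp add: transition_tensor_def)
  then show "repeat_blocks n P \<in> carrier_mat n (n ^ Suc m)"
    unfolding repeat_blocks_eq_kron by (auto simp: kron_mat_def ones_row_def)
  fix c assume c: "c < n ^ Suc m"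
  then have "c mod n ^ m < n ^ m" by (cases n) auto
  moreover have "\<forall>i<n. repeat_blocks n P $$ (i, c) = P $$ (i, c mod n ^ m)"
    unfolding repeat_blocks_eq_kron using P c
    by (auto simp: kron_mat_def ones_row_def less_mult_imp_div_less)
  ultimately show "\<exists>d<n ^ m. \<forall>i<n. repeat_blocks n P $$ (i, c) = P $$ (i, d)" by blast
qed

section \<open>Rearranging columns within a monomial class\<close>

definition exponents :: "nat \<Rightarrow> nat list \<Rightarrow> nat list" where
  "exponents n is = map (count_list is) [0..<n]"

lemma exponents_in_exponent_seqs:
  assumes "is \<in> multi_indices n m"
  shows "exponents n is \<in> exponent_seqs n m"
proof -
  have "sum_list (exponents n is) = (\<Sum>j<n. count_list is j)"
    by (simp add: exponents_def interv_sum_list_conv_sum_set_nat atLeast0LessThan)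
  also have "\<dots> = (\<Sum>j\<in>set is. count_list is j)"
    using assms by (intro sum.mono_neutral_right) (auto simp: multi_indices_def count_list_0_iff)
  also have "\<dots> = m"
    using assms by (simp add: sum_count_set [OF subset_refl] multi_indices_def)
  finally show ?thesis by (simp add: exponent_seqs_def exponents_def)
qed

lemma monomial_columns_eq:
  assumes "ms \<in> exponent_seqs n m"
  shows "monomial_columns n m ms = lex_index n ` {is \<in> multi_indices n m. exponents n is = ms}"
  using assms
  by (auto simp: monomial_columns_def exponents_def exponent_seqs_def list_eq_iff_nth_eq)

lemma monomial_columns_subset: "monomial_columns n m ms \<subseteq> {..<n ^ m}"
  using bij_betw_imp_surj_on [OF bij_betw_lex_index, of n m]
  by (auto simp: monomial_columns_def)

lemma in_monomial_columns:
  assumes "c < n ^ m"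
  shows "\<exists>ms\<in>exponent_seqs n m. c \<in> monomial_columns n m ms"
proof -
  obtain "is" where "is \<in> multi_indices n m" "c = lex_index n is"
    using assms bij_betw_imp_surj_on [OF bij_betw_lex_index, of n m] by auto
  then show ?thesis
    using exponents_in_exponent_seqs [of "is" n m] monomial_columns_eq by blast
qed

text \<open>Two multi-indices in one class are permutations of each other, that is, equal as
  multisets, and a product ignores the order of its factors.\<close>

lemma kron_pow_const_on_monomial_columns:
  assumes x: "x \<in> carrier_vec n"
    and c: "c \<in> monomial_columns n m ms" and d: "d \<in> monomial_columns n m ms"
  shows "kron_pow x m $ c = kron_pow x m $ d"
proof -
  obtain "is" js
    where "is": "is \<in> multi_indices n m" "\<forall>j<n. count_list is j = ms ! j" "c = lex_index n is"
      and js: "js \<in> multi_indices n m" "\<forall>j<n. count_list js j = ms ! j" "d = lex_index n js"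
    using c d by (auto simp: monomial_columns_def)
  have "mset is = mset js"
  proof (rule multiset_eqI)
    fix j
    show "count (mset is) j = count (mset js) j"
    proof (cases "j < n")
      case False
      then have "j \<notin> set is" "j \<notin> set js" using "is"(1) js(1) by (auto simp: multi_indices_def)
      then show ?thesis by (simp add: count_mset count_list_0_iff)
    qed (use "is"(2) js(2) in \<open>simp add: count_mset\<close>)
  qed
  then have "prod_mset (mset (map (\<lambda>i. x $ i) is)) = prod_mset (mset (map (\<lambda>i. x $ i) js))"
    by (simp only: mset_map)
  then show ?thesis
    unfolding "is"(3) js(3) kron_pow_lex_index [OF x "is"(1)] kron_pow_lex_index [OF x js(1)]
      prod_mset_prod_list .
qed

text \<open>The classes are indexed by the exponent sequences of actual multi-indices, which makes the
  index set finite for free; it is all of \<open>exponent_seqs n m\<close>.\<close>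

lemma sum_over_monomial_columns:
  fixes f :: "nat \<Rightarrow> real"
  shows "(\<Sum>c<n ^ m. f c) =
    (\<Sum>ms\<in>exponents n ` multi_indices n m. \<Sum>c\<in>monomial_columns n m ms. f c)"
proof -
  have fin: "finite (multi_indices n m)"
    using bij_betw_finite [OF bij_betw_lex_index, of n m] by simp
  have inj: "inj_on (lex_index n) (multi_indices n m)"
    using bij_betw_lex_index by (rule bij_betw_imp_inj_on)
  have "(\<Sum>c<n ^ m. f c) = (\<Sum>is\<in>multi_indices n m. f (lex_index n is))"
    by (rule sum.reindex_bij_betw [OF bij_betw_lex_index, symmetric])
  also have "\<dots> = (\<Sum>ms\<in>exponents n ` multi_indices n m.
      \<Sum>is\<in>{is \<in> multi_indices n m. exponents n is = ms}. f (lex_index n is))"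
    using fin by (intro sum.group [symmetric]) auto
  also have "\<dots> = (\<Sum>ms\<in>exponents n ` multi_indices n m. \<Sum>c\<in>monomial_columns n m ms. f c)"
  proof (rule sum.cong [OF refl])
    fix ms assume "ms \<in> exponents n ` multi_indices n m"
    then have "ms \<in> exponent_seqs n m" using exponents_in_exponent_seqs by blast
    from monomial_columns_eq [OF this]
    show "(\<Sum>is\<in>{is \<in> multi_indices n m. exponents n is = ms}. f (lex_index n is)) =
        (\<Sum>c\<in>monomial_columns n m ms. f c)"
      by (simp add: sum.reindex inj_on_subset [OF inj])
  qed
  finally show ?thesis .
qed

lemma column_rearrangement_col:
  assumes Q: "Q \<in> column_rearrangements n m A" and A: "A \<in> carrier_mat n (n ^ m)"
    and ms: "ms \<in> exponent_seqs n m"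
  obtains \<pi> where "\<pi> permutes monomial_columns n m ms"
    "\<And>c i. c \<in> monomial_columns n m ms \<Longrightarrow> i < n \<Longrightarrow> Q $$ (i, c) = A $$ (i, \<pi> c)"
proof -
  from Q ms obtain \<pi> where \<pi>: "\<pi> permutes monomial_columns n m ms"
    and eq: "\<forall>c\<in>monomial_columns n m ms. col Q c = col A (\<pi> c)"
    by (auto simp: column_rearrangements_def)
  have "Q $$ (i, c) = A $$ (i, \<pi> c)" if c: "c \<in> monomial_columns n m ms" and i: "i < n" for c i
  proof -
    have "\<pi> c < n ^ m" "c < n ^ m"
      using c permutes_in_image [OF \<pi>, of c] monomial_columns_subset by auto
    moreover have "Q \<in> carrier_mat n (n ^ m)" using Q by (simp add: column_rearrangements_def)
    moreover have "col Q c $ i = col A (\<pi> c) $ i" using eq c by simp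
    ultimately show ?thesis using A i by simp
  qed
  with \<pi> show ?thesis by (rule that)
qed

text \<open>Within a class, \<open>x\<^sup>(\<^sup>m\<^sup>)\<close> takes a constant value, so it may be evaluated at the permuted
  column; then the sum over the class is reindexed.\<close>

lemma column_rearrangement_mult_kron_pow:
  assumes Q: "Q \<in> column_rearrangements n m A" and A: "A \<in> carrier_mat n (n ^ m)"
    and x: "x \<in> carrier_vec n"
  shows "Q *\<^sub>v kron_pow x m = A *\<^sub>v kron_pow x m"
proof (rule eq_vecI)
  have Qc: "Q \<in> carrier_mat n (n ^ m)" using Q by (simp add: column_rearrangements_def)
  then show "dim_vec (Q *\<^sub>v kron_pow x m) = dim_vec (A *\<^sub>v kron_pow x m)" using A by simp
  note y = kron_pow_carrier [OF x, of m]
  fix i assume "i < dim_vec (A *\<^sub>v kron_pow x m)"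
  then have i: "i < n" using A by simp
  have class_sum: "(\<Sum>c\<in>monomial_columns n m ms. Q $$ (i, c) * kron_pow x m $ c) =
      (\<Sum>c\<in>monomial_columns n m ms. A $$ (i, c) * kron_pow x m $ c)"
    if ms: "ms \<in> exponent_seqs n m" for ms
  proof -
    obtain \<pi> where \<pi>: "\<pi> permutes monomial_columns n m ms"
      and eq: "\<And>c i. c \<in> monomial_columns n m ms \<Longrightarrow> i < n \<Longrightarrow> Q $$ (i, c) = A $$ (i, \<pi> c)"
      using column_rearrangement_col [OF Q A ms] by metis
    have "(\<Sum>c\<in>monomial_columns n m ms. Q $$ (i, c) * kron_pow x m $ c) =
        (\<Sum>c\<in>monomial_columns n m ms. A $$ (i, \<pi> c) * kron_pow x m $ \<pi> c)"
    proof (rule sum.cong [OF refl])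
      fix c assume c: "c \<in> monomial_columns n m ms"
      then have "\<pi> c \<in> monomial_columns n m ms" by (simp add: permutes_in_image [OF \<pi>])
      from kron_pow_const_on_monomial_columns [OF x c this]
      show "Q $$ (i, c) * kron_pow x m $ c = A $$ (i, \<pi> c) * kron_pow x m $ \<pi> c"
        using eq [OF c i] by simp
    qed
    also have "\<dots> = (\<Sum>c\<in>monomial_columns n m ms. A $$ (i, c) * kron_pow x m $ c)"
      using sum.permute [OF \<pi>, of "\<lambda>c. A $$ (i, c) * kron_pow x m $ c"] by (simp add: o_def)
    finally show ?thesis .
  qed
  show "(Q *\<^sub>v kron_pow x m) $ i = (A *\<^sub>v kron_pow x m) $ i"
    unfolding mult_mat_vec_index [OF Qc y i] mult_mat_vec_index [OF A y i]
      sum_over_monomial_columns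
    by (rule sum.cong [OF refl], rule class_sum) (use exponents_in_exponent_seqs in blast)
qed

lemma transition_tensor_column_rearrangement:
  assumes A: "transition_tensor n m A" and Q: "Q \<in> column_rearrangements n m A"
  shows "transition_tensor n m Q"
proof (rule transition_tensor_cols [OF A])
  show "Q \<in> carrier_mat n (n ^ m)" using Q by (simp add: column_rearrangements_def)
  have Ac: "A \<in> carrier_mat n (n ^ m)" using A by (simp add: transition_tensor_def)
  fix c assume "c < n ^ m"
  then obtain ms where ms: "ms \<in> exponent_seqs n m" and c: "c \<in> monomial_columns n m ms"
    using in_monomial_columns by blast
  obtain \<pi> where \<pi>: "\<pi> permutes monomial_columns n m ms"
    and eq: "\<And>c i. c \<in> monomial_columns n m ms \<Longrightarrow> i < n \<Longrightarrow> Q $$ (i, c) = A $$ (i, \<pi> c)"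
    using column_rearrangement_col [OF Q Ac ms] by metis
  have "\<pi> c < n ^ m"
    using c permutes_in_image [OF \<pi>, of c] monomial_columns_subset by auto
  with eq [OF c] show "\<exists>d<n ^ m. \<forall>i<n. Q $$ (i, c) = A $$ (i, d)" by blast
qed

section \<open>Convex combinations\<close>

lemma transition_tensor_convex_combination:
  assumes Q: "Q \<in> convex_combinations n (n ^ m) S"
    and S: "\<And>R. R \<in> S \<Longrightarrow> transition_tensor n m R"
  shows "transition_tensor n m Q"
proof -
  from Q obtain k and w :: "nat \<Rightarrow> real" and R
    where Q_eq: "Q = mat n (n ^ m) (\<lambda>ij. \<Sum>l<k. w l * R l $$ ij)"
      and R: "\<And>l. l < k \<Longrightarrow> R l \<in> S" and w: "\<And>l. l < k \<Longrightarrow> 0 \<le> w l" "(\<Sum>l<k. w l) = 1"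
    by (auto simp: convex_combinations_def)
  have tt: "transition_tensor n m (R l)" if "l < k" for l
    using S R that by blast
  have "(\<Sum>i<n. Q $$ (i, c)) = 1" if c: "c < n ^ m" for c
  proof -
    have "(\<Sum>i<n. Q $$ (i, c)) = (\<Sum>i<n. \<Sum>l<k. w l * R l $$ (i, c))"
      using c by (simp add: Q_eq)
    also have "\<dots> = (\<Sum>l<k. w l * (\<Sum>i<n. R l $$ (i, c)))"
      by (subst sum.swap) (simp add: sum_distrib_left)
    also have "\<dots> = (\<Sum>l<k. w l)"
      using tt c by (intro sum.cong) (auto simp: transition_tensor_iff)
    finally show ?thesis using w(2) by simp
  qed
  moreover have "0 \<le> Q $$ (i, c)" if "i < n" "c < n ^ m" for i c
    using that tt w(1) by (auto simp: Q_eq transition_tensor_iff intro!: sum_nonneg)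
  ultimately show ?thesis by (auto simp: transition_tensor_iff Q_eq)
qed

lemma convex_combination_mult_vec:
  assumes Q: "Q \<in> convex_combinations r c S"
    and S: "\<And>R. R \<in> S \<Longrightarrow> R \<in> carrier_mat r c \<and> R *\<^sub>v y = z"
    and y: "y \<in> carrier_vec c" and z: "z \<in> carrier_vec r"
  shows "Q *\<^sub>v y = z"
proof (rule eq_vecI)
  from Q obtain k and w :: "nat \<Rightarrow> real" and R
    where Q_eq: "Q = mat r c (\<lambda>ij. \<Sum>l<k. w l * R l $$ ij)"
      and R: "\<And>l. l < k \<Longrightarrow> R l \<in> S" and w: "(\<Sum>l<k. w l) = 1"
    by (auto simp: convex_combinations_def)
  have Qc: "Q \<in> carrier_mat r c" by (simp add: Q_eq)
  then show "dim_vec (Q *\<^sub>v y) = dim_vec z" using z by simp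
  fix i assume "i < dim_vec z"
  then have i: "i < r" using z by simp
  have "(Q *\<^sub>v y) $ i = (\<Sum>j<c. \<Sum>l<k. w l * (R l $$ (i, j) * y $ j))"
    unfolding mult_mat_vec_index [OF Qc y i]
    using i by (intro sum.cong) (auto simp: Q_eq sum_distrib_right mult.assoc)
  also have "\<dots> = (\<Sum>l<k. w l * (\<Sum>j<c. R l $$ (i, j) * y $ j))"
    by (subst sum.swap) (simp add: sum_distrib_left)
  also have "\<dots> = (\<Sum>l<k. w l * z $ i)"
  proof (rule sum.cong [OF refl])
    fix l assume "l \<in> {..<k}"
    then have "R l \<in> carrier_mat r c" "R l *\<^sub>v y = z" using S R by auto
    then show "w l * (\<Sum>j<c. R l $$ (i, j) * y $ j) = w l * z $ i"
      using mult_mat_vec_index [of "R l" r c y i] y i by simp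
  qed
  also have "\<dots> = z $ i" using w by (simp flip: sum_distrib_right)
  finally show "(Q *\<^sub>v y) $ i = z $ i" .
qed

section \<open>Stationarity of all rearrangements\<close>

theorem theorem3p1:
  fixes m n :: nat and P Pt :: "real mat"
  assumes "m \<ge> 2" and "n \<ge> 2"
    and "transition_tensor n (m - 1) P"
    and "\<forall>x\<in>prob_simplex n. P *\<^sub>v kron_pow x (m - 1) = x"
    and "Pt = repeat_blocks n P"
  shows "Pt = ones_row n \<otimes>\<^sub>m P \<and> Pt \<in> carrier_mat n (n ^ m) \<and>
    (\<forall>x\<in>prob_simplex n.
       Pt *\<^sub>v kron_pow x m = (ones_row n \<otimes>\<^sub>m P) *\<^sub>v (x \<otimes>\<^sub>v kron_pow x (m - 1)) \<and>
       (ones_row n \<otimes>\<^sub>m P) *\<^sub>v (x \<otimes>\<^sub>v kron_pow x (m - 1)) =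
         (ones_row n *\<^sub>v x) \<otimes>\<^sub>v (P *\<^sub>v kron_pow x (m - 1)) \<and>
       (ones_row n *\<^sub>v x) \<otimes>\<^sub>v (P *\<^sub>v kron_pow x (m - 1)) = x) \<and>
    (\<forall>Q\<in>column_rearrangements n m Pt.
       transition_tensor n m Q \<and> (\<forall>x\<in>prob_simplex n. Q *\<^sub>v kron_pow x m = x)) \<and>
    (\<forall>Q\<in>convex_combinations n (n ^ m) (column_rearrangements n m Pt).
       transition_tensor n m Q \<and> (\<forall>x\<in>prob_simplex n. Q *\<^sub>v kron_pow x m = x))"
proof -
  have P: "P \<in> carrier_mat n (n ^ (m - 1))"
    using assms(3) by (simp add: transition_tensor_def)
  have m: "Suc (m - 1) = m" using assms(1) by simp
  have Pt: "Pt = ones_row n \<otimes>\<^sub>m P"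
    using assms(5) by (simp add: repeat_blocks_eq_kron)
  have tt: "transition_tensor n m Pt"
    using transition_tensor_repeat_blocks [OF assms(3)] m assms(5) by simp
  then have Ptc: "Pt \<in> carrier_mat n (n ^ m)"
    by (simp add: transition_tensor_def)
  have xc: "x \<in> carrier_vec n" if "x \<in> prob_simplex n" for x
    using that by (simp add: prob_simplex_def)
  have pow: "kron_pow x m = x \<otimes>\<^sub>v kron_pow x (m - 1)" for x
    using kron_pow.simps(2) [of x "m - 1"] m by simp
  have mixed: "(ones_row n \<otimes>\<^sub>m P) *\<^sub>v (x \<otimes>\<^sub>v kron_pow x (m - 1)) =
      (ones_row n *\<^sub>v x) \<otimes>\<^sub>v (P *\<^sub>v kron_pow x (m - 1))" if "x \<in> prob_simplex n" for x
    by (rule kron_mat_mult_kron_vec [of _ 1 n _ n "n ^ (m - 1)"])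
      (use P xc [OF that] in \<open>auto simp: ones_row_def intro!: kron_pow_carrier\<close>)
  have last: "(ones_row n *\<^sub>v x) \<otimes>\<^sub>v (P *\<^sub>v kron_pow x (m - 1)) = x"
    if "x \<in> prob_simplex n" for x
    by (simp only: ones_row_mult_prob_simplex [OF that] one_kron_vec bspec [OF assms(4) that])
  have stat: "Pt *\<^sub>v kron_pow x m = x" if "x \<in> prob_simplex n" for x
    using mixed [OF that] last [OF that] by (simp only: Pt pow)
  have rearr: "Q *\<^sub>v kron_pow x m = x"
    if "Q \<in> column_rearrangements n m Pt" "x \<in> prob_simplex n" for Q x
    using column_rearrangement_mult_kron_pow [OF that(1) Ptc xc [OF that(2)]] stat [OF that(2)]
    by simp
  have conv: "Q *\<^sub>v kron_pow x m = x"
    if Q: "Q \<in> convex_combinations n (n ^ m) (column_rearrangements n m Pt)"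
      and x: "x \<in> prob_simplex n" for Q x
    using Q
  proof (rule convex_combination_mult_vec)
    fix R assume R: "R \<in> column_rearrangements n m Pt"
    then show "R \<in> carrier_mat n (n ^ m) \<and> R *\<^sub>v kron_pow x m = x"
      using rearr [OF R x] by (simp add: column_rearrangements_def)
  qed (use xc [OF x] kron_pow_carrier in auto)
  have tt_rearr: "transition_tensor n m Q" if "Q \<in> column_rearrangements n m Pt" for Q
    using transition_tensor_column_rearrangement [OF tt that] .
  have tt_conv: "transition_tensor n m Q"
    if "Q \<in> convex_combinations n (n ^ m) (column_rearrangements n m Pt)" for Q
    using that tt_rearr by (rule transition_tensor_convex_combination)
  have chain: "Pt *\<^sub>v kron_pow x m = (ones_row n \<otimes>\<^sub>m P) *\<^sub>v (x \<otimes>\<^sub>v kron_pow x (m - 1))" for x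
    by (simp only: Pt pow)
  show ?thesis
    by (intro conjI ballI; (rule Pt Ptc chain mixed last rearr conv tt_rearr tt_conv; assumption))
qed

end
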